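(* Let $F$ be the face $(\hat U_{3,5}^{1},U_{1,3}^{234})$ of $\Gamma_4$. For real $a,b\ge 0$, the point $\mathbf h=(a,b)\in F$ is entropic if and only if $a=\log v$ for some integer $v\ge 1$.
   Context: $N_4=\{1,2,3,4\}$. $\Gamma_4$ is the cone of all polymatroid rank functions on $N_4$. A set function $\mathbf h:2^{N_4}\to\mathbb R$ is called entropic if there is a random vector $(X_1,X_2,X_3,X_4)$, each $X_i$ taking values in a finite set, with $\mathbf h(A)=H(X_A)$ for all $A\subseteq N_4$, where $H$ is Shannon entropy, $X_A=(X_j,j\in A)$ and $\mathbf h(\emptyset)=0$. Logarithms (also in the entropy) are to base $2$. For two (poly)matroids $M_1,M_2$ on $N_4$ with rank functions $\mathbf r_1,\mathbf r_2$, $(M_1,M_2)$ denotes the face $\{a\mathbf r_1+b\mathbf r_2:a,b\ge0\}$ of $\Gamma_4$, and $(a,b)$ denotes the point $a\mathbf r_1+b\mathbf r_2$. $\hat U^1_{3,5}$ is the integer polymatroid on $N_4$ with rank function $\mathbf r(A)=\min\{3,|A|+1\}$ if $1\in A$ and $\mathbf r(A)=|A|$ if $1\notin A$. $U^{234}_{1,3}$ is the matroid on $N_4$ with $\mathbf r(A)=\min\{1,|A\cap\{2,3,4\}|\}$. *)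

theory Defs
  imports "HOL-Probability.Probability"
begin

abbreviation N4 :: "nat set" where
  "N4 \<equiv> {1, 2, 3, 4}"

section \<open>Polymatroids\<close>

text \<open>Set functions on the subsets of \<open>N4\<close> are rendered as functions on \<open>nat set\<close> of which
  only the values on subsets of \<open>N4\<close> matter.\<close>

definition Gamma4 :: "(nat set \<Rightarrow> real) set" where
  "Gamma4 = {r. r {} = 0
     \<and> (\<forall>A B. A \<subseteq> B \<and> B \<subseteq> N4 \<longrightarrow> r A \<le> r B)
     \<and> (\<forall>A B. A \<subseteq> N4 \<and> B \<subseteq> N4 \<longrightarrow> r (A \<union> B) + r (A \<inter> B) \<le> r A + r B)}"

definition face_point ::
    "(nat set \<Rightarrow> real) \<Rightarrow> (nat set \<Rightarrow> real) \<Rightarrow> real \<Rightarrow> real \<Rightarrow> nat set \<Rightarrow> real" where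
  "face_point r1 r2 a b = (\<lambda>A. a * r1 A + b * r2 A)"

definition face :: "(nat set \<Rightarrow> real) \<Rightarrow> (nat set \<Rightarrow> real) \<Rightarrow> (nat set \<Rightarrow> real) set" where
  "face r1 r2 = {face_point r1 r2 a b | a b. 0 \<le> a \<and> 0 \<le> b}"

definition U_hat_1_35 :: "nat set \<Rightarrow> real" where
  "U_hat_1_35 A = (if 1 \<in> A then min 3 (real (card A) + 1) else real (card A))"

definition U_234_13 :: "nat set \<Rightarrow> real" where
  "U_234_13 A = min 1 (real (card (A \<inter> {2, 3, 4})))"

lemma U_hat_1_35_in_Gamma4: "U_hat_1_35 \<in> Gamma4"
proof -
  have "U_hat_1_35 A \<le> U_hat_1_35 B" if AB: "A \<subseteq> B" and B: "B \<subseteq> N4" for A B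
  proof -
    have "finite B" using B by (rule finite_subset) simp
    moreover have "card B \<le> 3" if "1 \<notin> B"
    proof -
      have "B \<subseteq> {2, 3, 4}" using B that by auto
      then have "card B \<le> card {2, 3, 4 :: nat}" by (intro card_mono) simp_all
      then show ?thesis by simp
    qed
    moreover have "1 \<in> B" if "1 \<in> A" using AB that by blast
    moreover have "card A < card B" if "1 \<in> B" "1 \<notin> A"
      using AB that \<open>finite B\<close> by (intro psubset_card_mono) auto
    moreover have "card A \<le> 3" if "1 \<notin> A"
    proof -
      have "A \<subseteq> {2, 3, 4}" using AB B that by auto
      then have "card A \<le> card {2, 3, 4 :: nat}" by (intro card_mono) simp_all
      then show ?thesis by simp
    qed
    moreover have "card A \<le> card B" using \<open>finite B\<close> AB by (rule card_mono)
    ultimately show ?thesis by (cases "1 \<in> A"; cases "1 \<in> B") (simp_all add: U_hat_1_35_def)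
  qed
  moreover have "U_hat_1_35 (A \<union> B) + U_hat_1_35 (A \<inter> B) \<le> U_hat_1_35 A + U_hat_1_35 B"
    if A: "A \<subseteq> N4" and B: "B \<subseteq> N4" for A B
  proof -
    have fin: "finite A" "finite B" using A B by (auto intro: finite_subset)
    have "real (card A) + real (card B) = real (card (A \<union> B)) + real (card (A \<inter> B))"
      using card_Un_Int[OF fin] by simp
    moreover have "real (card (A \<inter> B)) \<le> real (card A)" "real (card (A \<inter> B)) \<le> real (card B)"
      using fin by (simp_all add: card_mono)
    ultimately show ?thesis
      by (cases "1 \<in> A"; cases "1 \<in> B") (simp_all add: U_hat_1_35_def min_def)
  qed
  ultimately show ?thesis unfolding Gamma4_def by (simp add: U_hat_1_35_def)
qed

lemma U_234_13_in_Gamma4: "U_234_13 \<in> Gamma4"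
proof -
  have "U_234_13 A \<le> U_234_13 B" if AB: "A \<subseteq> B" for A B
  proof -
    have "card (A \<inter> {2, 3, 4}) \<le> card (B \<inter> {2, 3, 4})" using AB by (intro card_mono) auto
    then show ?thesis by (simp add: U_234_13_def)
  qed
  moreover have "U_234_13 (A \<union> B) + U_234_13 (A \<inter> B) \<le> U_234_13 A + U_234_13 B" for A B
  proof -
    define C where "C = A \<inter> {2, 3, 4}"
    define D where "D = B \<inter> {2, 3, 4}"
    have fin: "finite C" "finite D" by (simp_all add: C_def D_def)
    have e: "card C + card D = card (C \<union> D) + card (C \<inter> D)" by (rule card_Un_Int[OF fin])
    have le: "card (C \<inter> D) \<le> card C" "card (C \<inter> D) \<le> card D"
      using fin by (simp_all add: card_mono)
    have eqs: "(A \<union> B) \<inter> {2, 3, 4} = C \<union> D" "(A \<inter> B) \<inter> {2, 3, 4} = C \<inter> D"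
      by (auto simp: C_def D_def)
    have "min 1 (card (C \<union> D)) + min 1 (card (C \<inter> D)) \<le> min 1 (card C) + min 1 (card D)"
      using e le by linarith
    then show ?thesis
      unfolding U_234_13_def eqs C_def[symmetric] D_def[symmetric] by linarith
  qed
  ultimately show ?thesis unfolding Gamma4_def by (simp add: U_234_13_def)
qed

lemma face_subset_Gamma4:
  assumes "r1 \<in> Gamma4" "r2 \<in> Gamma4"
  shows "face r1 r2 \<subseteq> Gamma4"
proof -
  have "face_point r1 r2 a b \<in> Gamma4" if ab: "0 \<le> a" "0 \<le> b" for a b
  proof -
    have "face_point r1 r2 a b A \<le> face_point r1 r2 a b B" if "A \<subseteq> B" "B \<subseteq> N4" for A B
    proof -
      have "r1 A \<le> r1 B" "r2 A \<le> r2 B" using assms that by (simp_all add: Gamma4_def)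
      then show ?thesis using ab by (simp add: face_point_def add_mono mult_left_mono)
    qed
    moreover have "face_point r1 r2 a b (A \<union> B) + face_point r1 r2 a b (A \<inter> B)
        \<le> face_point r1 r2 a b A + face_point r1 r2 a b B" if "A \<subseteq> N4" "B \<subseteq> N4" for A B
    proof -
      have "a * (r1 (A \<union> B) + r1 (A \<inter> B)) \<le> a * (r1 A + r1 B)"
           "b * (r2 (A \<union> B) + r2 (A \<inter> B)) \<le> b * (r2 A + r2 B)"
        using assms ab that by (simp_all add: Gamma4_def mult_left_mono)
      then show ?thesis by (simp add: face_point_def algebra_simps)
    qed
    moreover have "face_point r1 r2 a b {} = 0"
      using assms by (simp add: face_point_def Gamma4_def)
    ultimately show ?thesis by (simp add: Gamma4_def)
  qed
  then show ?thesis unfolding face_def by blast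
qed

section \<open>Entropic set functions\<close>

definition subvector :: "(nat \<Rightarrow> 'a \<Rightarrow> 'b) \<Rightarrow> nat set \<Rightarrow> 'a \<Rightarrow> nat \<Rightarrow> 'b" where
  "subvector X A = (\<lambda>\<omega>. \<lambda>i\<in>A. X i \<omega>)"

text \<open>A random variable with finitely many values is a \<^const>\<open>simple_function\<close>.
  The entropy is the library's Shannon entropy to base 2, relative to counting measure
  on the range.\<close>

definition has_entropy_function ::
    "'a measure \<Rightarrow> (nat \<Rightarrow> 'a \<Rightarrow> 'b) \<Rightarrow> (nat set \<Rightarrow> real) \<Rightarrow> bool" where
  "has_entropy_function M X h \<longleftrightarrow>
     prob_space M \<and> (\<forall>i\<in>N4. simple_function M (X i)) \<and> h {} = 0 \<and>
     (\<forall>A. A \<subseteq> N4 \<longrightarrow>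
        h A = prob_space.entropy M 2 (count_space (subvector X A ` space M)) (subvector X A))"

text \<open>Types cannot be quantified existentially, so sample space and values are taken in \<open>nat\<close>;
  \<open>entropic_if_has_entropy_function\<close> below shows that this is no restriction.\<close>

definition entropic :: "(nat set \<Rightarrow> real) \<Rightarrow> bool" where
  "entropic h \<longleftrightarrow> (\<exists>(M :: nat measure) (X :: nat \<Rightarrow> nat \<Rightarrow> nat). has_entropy_function M X h)"

lemma entropy_simple_function:
  assumes "prob_space M" and Y: "simple_function M Y"
  shows "prob_space.entropy M 2 (count_space (Y ` space M)) Y =
    - (\<Sum>y\<in>Y ` space M. measure M (Y -` {y} \<inter> space M) * log 2 (measure M (Y -` {y} \<inter> space M)))"
proof -
  interpret prob_space M by fact
  interpret information_space M 2 by unfold_locales simp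
  have "simple_distributed M Y (\<lambda>y. measure M (Y -` {y} \<inter> space M))"
    by (rule simple_distributedI[OF Y]) (auto simp: measure_nonneg)
  then show ?thesis by (rule entropy_simple_distributed)
qed

lemma simple_function_subvector:
  assumes "finite A" "\<And>i. i \<in> A \<Longrightarrow> simple_function M (X i)"
  shows "simple_function M (subvector X A)"
proof -
  have fin: "finite (subvector X A ` space M)"
  proof (rule finite_subset)
    show "subvector X A ` space M \<subseteq> (\<Pi>\<^sub>E i\<in>A. X i ` space M)"
      by (auto simp: subvector_def)
    show "finite (\<Pi>\<^sub>E i\<in>A. X i ` space M)"
      using assms by (intro finite_PiE) (auto simp: simple_function_def)
  qed
  have "subvector X A -` {y} \<inter> space M \<in> sets M" if y_in: "y \<in> subvector X A ` space M" for y
  proof -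
    have "subvector X A -` {y} \<inter> space M = {\<omega> \<in> space M. \<forall>i\<in>A. X i \<omega> = y i}"
    proof -
      obtain \<omega>0 where y: "y = subvector X A \<omega>0" using y_in by auto
      have "subvector X A \<omega> = y \<longleftrightarrow> (\<forall>i\<in>A. X i \<omega> = y i)" for \<omega>
        unfolding y subvector_def restrict_def fun_eq_iff by (simp cong: conj_cong) blast
      then show ?thesis by auto
    qed
    also have "\<dots> \<in> sets M"
    proof (rule sets.sets_Collect_finite_All[OF _ assms(1)])
      fix i assume "i \<in> A"
      have "X i -` {y i} \<inter> space M \<in> sets M"
        using assms(2)[OF \<open>i \<in> A\<close>] by (rule simple_functionD)
      moreover have "X i -` {y i} \<inter> space M = {\<omega> \<in> space M. X i \<omega> = y i}" by auto
      ultimately show "{\<omega> \<in> space M. X i \<omega> = y i} \<in> sets M" by simp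
    qed
    finally show ?thesis .
  qed
  then show ?thesis using fin by (simp add: simple_function_def)
qed

lemma entropy_transfer:
  assumes M: "prob_space M" and Y: "simple_function M Y" and Y': "simple_function N Y'"
    and G: "G \<in> measurable M N" and surj: "G ` space M = space N"
    and inj: "inj_on \<phi> (Y ` space M)"
    and eq: "\<And>\<omega>. \<omega> \<in> space M \<Longrightarrow> Y' (G \<omega>) = \<phi> (Y \<omega>)"
  defines "M' \<equiv> distr M N G"
  shows "prob_space.entropy M' 2 (count_space (Y' ` space M')) Y' =
         prob_space.entropy M 2 (count_space (Y ` space M)) Y"
proof -
  have M': "prob_space M'" unfolding M'_def by (rule prob_space.prob_space_distr[OF M G])
  have sp: "space M' = space N" and se: "sets M' = sets N" by (simp_all add: M'_def)
  have Y'': "simple_function M' Y'"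
    using Y' by (simp add: simple_function_def sp se)
  have im: "Y' ` space M' = \<phi> ` (Y ` space M)"
    unfolding sp surj[symmetric] image_image by (rule image_cong) (auto simp: eq)
  have p: "measure M' (Y' -` {\<phi> y} \<inter> space M') = measure M (Y -` {y} \<inter> space M)"
    if "y \<in> Y ` space M" for y
  proof -
    have "Y' -` {\<phi> y} \<inter> space N \<in> sets N" using Y' by (rule simple_functionD)
    then have "measure M' (Y' -` {\<phi> y} \<inter> space M')
        = measure M (G -` (Y' -` {\<phi> y} \<inter> space N) \<inter> space M)"
      unfolding M'_def by (simp add: measure_distr[OF G])
    also have "G -` (Y' -` {\<phi> y} \<inter> space N) \<inter> space M = Y -` {y} \<inter> space M"
      using surj that inj by (auto simp: eq inj_on_def)
    finally show ?thesis .
  qed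
  show ?thesis
    unfolding entropy_simple_function[OF M' Y''] entropy_simple_function[OF M Y]
    unfolding im sum.reindex[OF inj] by (simp add: p cong: sum.cong)
qed

theorem entropic_if_has_entropy_function:
  fixes M :: "'a measure" and X :: "nat \<Rightarrow> 'a \<Rightarrow> 'b"
  assumes "has_entropy_function M X h"
  shows "entropic h"
proof -
  have M: "prob_space M" and X: "\<And>i. i \<in> N4 \<Longrightarrow> simple_function M (X i)" and h0: "h {} = 0"
    and h: "\<And>A. A \<subseteq> N4 \<Longrightarrow>
      h A = prob_space.entropy M 2 (count_space (subvector X A ` space M)) (subvector X A)"
    using assms unfolding has_entropy_function_def by blast+
  define T where "T = subvector X N4"
  define I where "I = T ` space M"
  define g where "g = to_nat_on I"
  define V where "V = (\<Union>i\<in>N4. X i ` space M)"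
  define c where "c = to_nat_on V"
  define N where "N = count_space (g ` I)"
  define G where "G = g \<circ> T"
  define X' where "X' = (\<lambda>i n. c (from_nat_into I n i))"
  have T: "simple_function M T"
    unfolding T_def by (rule simple_function_subvector) (use X in auto)
  then have finI: "finite I" by (simp add: I_def simple_function_def)
  have finV: "finite V" unfolding V_def using X by (auto simp: simple_function_def)
  have injc: "inj_on c V" unfolding c_def by (rule inj_on_to_nat_on[OF countable_finite[OF finV]])
  have surj: "G ` space M = space N" by (simp add: G_def N_def I_def image_comp)
  have "simple_function M G" unfolding G_def using T by (rule simple_function_compose1[unfolded o_def[symmetric]])
  then have G: "G \<in> measurable M N"
    unfolding N_def using surj finI
    by (intro measurable_count_space_eq2[THEN iffD2]) (auto simp: N_def dest: simple_functionD)
  have X'G: "X' i (G \<omega>) = c (X i \<omega>)" if "i \<in> N4" "\<omega> \<in> space M" for i \<omega>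
  proof -
    have "T \<omega> \<in> I" using that by (simp add: I_def)
    then have "from_nat_into I (G \<omega>) = T \<omega>"
      unfolding G_def g_def using finI by (simp add: countable_finite)
    then show ?thesis using that(1) unfolding X'_def T_def subvector_def by simp
  qed
  have "h A = prob_space.entropy (distr M N G) 2
      (count_space (subvector X' A ` space (distr M N G))) (subvector X' A)" if A: "A \<subseteq> N4" for A
  proof -
    have "finite A" using A by (rule finite_subset) simp
    then have "simple_function M (subvector X A)"
      by (rule simple_function_subvector) (use X A in blast)
    moreover have "inj_on (\<lambda>f. \<lambda>i\<in>A. c (f i)) (subvector X A ` space M)"
    proof (rule inj_onI)
      fix x y assume xy: "x \<in> subvector X A ` space M" "y \<in> subvector X A ` space M"
        and e: "(\<lambda>i\<in>A. c (x i)) = (\<lambda>i\<in>A. c (y i))"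
      have "x i = y i" for i
      proof (cases "i \<in> A")
        case True
        then have "x i \<in> V" "y i \<in> V" using xy A unfolding V_def subvector_def by auto
        moreover have "c (x i) = c (y i)" using fun_cong[OF e, of i] True by simp
        ultimately show ?thesis using injc by (auto dest: inj_onD)
      next
        case False
        then show ?thesis using xy unfolding subvector_def by auto
      qed
      then show "x = y" by auto
    qed
    moreover have "subvector X' A (G \<omega>) = (\<lambda>i\<in>A. c (subvector X A \<omega> i))"
      if "\<omega> \<in> space M" for \<omega>
      unfolding subvector_def using X'G[OF _ that] A by (auto simp: restrict_def fun_eq_iff)
    moreover have "simple_function N (subvector X' A)"
      unfolding N_def using finI by (simp add: simple_function_def)
    ultimately show ?thesis
      unfolding h[OF A] by (intro entropy_transfer[OF M _ _ G surj, symmetric])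
  qed
  moreover have "prob_space (distr M N G)" by (rule prob_space.prob_space_distr[OF M G])
  moreover have "simple_function (distr M N G) (X' i)" for i
    using finI by (simp add: simple_function_def N_def)
  ultimately have "has_entropy_function (distr M N G) X' h"
    unfolding has_entropy_function_def using h0 by blast
  then show ?thesis unfolding entropic_def by blast
qed

end

(* Only if: the entropy identities say that X2, X3, X4 are pairwise conditionally independent
   given the third, that X1 is independent of each of them, and that X1 together with any one of
   them, as well as X2, X3, X4 together, determine everything. So an atom (x1, x2, x3, x4) has
   probability p(x1) p(xi) for i = 2, 3, 4; hence p(x2) = p(x3) = p(x4),
   p(x2,x3) = p(x2,x4) = p(x3,x4) and p(x1) = p(x3|x2)^2. Fix x2. By conditional independence
   every x3 and x4 compatible with x2 occur jointly, so p(x3|x2) has a constant value 1/n on its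
   support. Every x1 occurs together with x2, so X1 is uniform on n^2 values and 2a = 2 log n.

   If: take U2, U3, U4 independent and uniform modulo v, an independent G of entropy b,
   Xi = (Ui, G) and X1 = (U2 - U3, U3 - U4). *)
theory Submission
  imports Defs "HOL-Real_Asymp.Real_Asymp"
begin

section \<open>Entropy, Gibbs' inequality and conditional independence\<close>

lemma (in prob_space) prob_marginal:
  assumes W: "simple_function M W" and E: "E \<in> sets M"
  shows "prob E = (\<Sum>j\<in>W ` space M. prob (E \<inter> (W -` {j} \<inter> space M)))"
proof -
  have "prob (\<Union>j\<in>W ` space M. E \<inter> (W -` {j} \<inter> space M)) =
      (\<Sum>j\<in>W ` space M. prob (E \<inter> (W -` {j} \<inter> space M)))"
  proof (rule finite_measure_finite_Union)
    show "finite (W ` space M)" using W by (rule simple_functionD)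
    show "(\<lambda>j. E \<inter> (W -` {j} \<inter> space M)) ` W ` space M \<subseteq> sets M"
      using simple_functionD(2)[OF W] E by blast
    show "disjoint_family_on (\<lambda>j. E \<inter> (W -` {j} \<inter> space M)) (W ` space M)"
      by (auto simp: disjoint_family_on_def)
  qed
  moreover have "(\<Union>j\<in>W ` space M. E \<inter> (W -` {j} \<inter> space M)) = E"
    using sets.sets_into_space[OF E] by auto
  ultimately show ?thesis by simp
qed

text \<open>Entropy is a mean of negative logarithms of probabilities, and this mean may be taken
  over any finer variable \<open>W\<close>. Entropies of different variables thus get a common index
  set and can be compared term by term.\<close>

lemma (in prob_space) entropy_refine:
  assumes W: "simple_function M W" and Y: "simple_function M Y"
    and g: "\<And>\<omega>. \<omega> \<in> space M \<Longrightarrow> Y \<omega> = g (W \<omega>)"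
  shows "entropy 2 (count_space (Y ` space M)) Y =
    - (\<Sum>j\<in>W ` space M. prob (W -` {j} \<inter> space M) * log 2 (prob (Y -` {g j} \<inter> space M)))"
proof -
  let ?L = "\<lambda>y. log 2 (prob (Y -` {y} \<inter> space M))"
  have fin: "finite (W ` space M)" using W by (rule simple_functionD)
  have im: "Y ` space M = g ` W ` space M" using g by force
  have "prob (Y -` {y} \<inter> space M) = (\<Sum>j\<in>{j\<in>W ` space M. g j = y}. prob (W -` {j} \<inter> space M))" for y
  proof -
    have "prob (Y -` {y} \<inter> space M)
        = (\<Sum>j\<in>W ` space M. prob ((Y -` {y} \<inter> space M) \<inter> (W -` {j} \<inter> space M)))"
      by (rule prob_marginal[OF W]) (rule simple_functionD[OF Y])
    also have "\<dots> = (\<Sum>j\<in>W ` space M. if g j = y then prob (W -` {j} \<inter> space M) else 0)"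
    proof (rule sum.cong[OF refl])
      fix j assume "j \<in> W ` space M"
      have "(Y -` {y} \<inter> space M) \<inter> (W -` {j} \<inter> space M)
          = (if g j = y then W -` {j} \<inter> space M else {})"
        using g by auto
      then show "prob ((Y -` {y} \<inter> space M) \<inter> (W -` {j} \<inter> space M))
          = (if g j = y then prob (W -` {j} \<inter> space M) else 0)" by simp
    qed
    also have "\<dots> = (\<Sum>j\<in>{j\<in>W ` space M. g j = y}. prob (W -` {j} \<inter> space M))"
      using fin by (simp add: sum.inter_filter)
    finally show ?thesis .
  qed
  then have "(\<Sum>y\<in>Y ` space M. prob (Y -` {y} \<inter> space M) * ?L y)
      = (\<Sum>y\<in>g ` W ` space M. \<Sum>j\<in>{j\<in>W ` space M. g j = y}. prob (W -` {j} \<inter> space M) * ?L (g j))"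
    unfolding im by (auto intro!: sum.cong simp: sum_distrib_right)
  also have "\<dots> = (\<Sum>j\<in>W ` space M. prob (W -` {j} \<inter> space M) * ?L (g j))"
    by (rule sum.image_gen[OF fin, symmetric])
  finally show ?thesis using entropy_simple_function[OF prob_space_axioms Y] by simp
qed

text \<open>\<open>p j (ln (q j) - ln (p j)) \<le> q j - p j\<close> termwise; as the sums agree, each of these is an
  equality.\<close>

lemma gibbs_equality:
  fixes p q :: "'a \<Rightarrow> real"
  assumes fin: "finite J" and p: "\<And>j. j \<in> J \<Longrightarrow> 0 \<le> p j" and q: "\<And>j. j \<in> J \<Longrightarrow> 0 \<le> q j"
    and sums: "sum q J = sum p J"
    and pos: "\<And>j. j \<in> J \<Longrightarrow> 0 < p j \<Longrightarrow> 0 < q j"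
    and eq: "(\<Sum>j\<in>J. p j * log 2 (p j)) = (\<Sum>j\<in>J. p j * log 2 (q j))"
    and j: "j \<in> J"
  shows "p j = q j"
proof -
  let ?d = "\<lambda>j. (q j - p j) - p j * (ln (q j) - ln (p j))"
  \<comment> \<open>With t = \<open>q j / p j\<close> the gap is \<open>p j\<close> times t - 1 - ln
    t, which is nonnegative and vanishes only at t = 1.\<close>
  have d: "?d j = p j * ((q j / p j - 1) - ln (q j / p j))" if "j \<in> J" "0 < p j" for j
    using pos[OF that] that by (simp add: ln_div algebra_simps)
  have nonneg: "0 \<le> ?d j" if "j \<in> J" for j
  proof (cases "p j = 0")
    case True
    then show ?thesis using q[OF that] by simp
  next
    case False
    then have "0 < p j" using p[OF that] by simp
    then show ?thesis
      unfolding d[OF that \<open>0 < p j\<close>]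
      using ln_le_minus_one[of "q j / p j"] pos[OF that] by simp
  qed
  have "(\<Sum>j\<in>J. p j * ln (p j)) = (\<Sum>j\<in>J. p j * ln (q j))"
  proof -
    have "(\<Sum>j\<in>J. p j * ln (p j)) / ln 2 = (\<Sum>j\<in>J. p j * ln (q j)) / ln 2"
      using eq by (simp add: log_def sum_divide_distrib)
    then show ?thesis by simp
  qed
  then have "sum ?d J = 0"
    using sums by (simp add: sum_subtractf right_diff_distrib)
  then have d0: "?d j = 0" using sum_nonneg_eq_0_iff[OF fin, of ?d] nonneg j by blast
  show ?thesis
  proof (cases "p j = 0")
    case False
    then have pj: "0 < p j" using p[OF j] by simp
    then have "ln (q j / p j) = q j / p j - 1"
      using d0 unfolding d[OF j pj] by simp
    then have "q j / p j = 1" using ln_eq_minus_one[of "q j / p j"] pos[OF j pj] pj by simp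
    then show ?thesis using pj by simp
  qed (use d0 in simp)
qed

text \<open>\<open>X\<close> and \<open>Y\<close> may coincide; the conclusion then says that \<open>X\<close> is a function of \<open>Z\<close>.\<close>

lemma (in prob_space) conditional_indep_of_entropy_eq:
  assumes X: "simple_function M X" and Y: "simple_function M Y" and Z: "simple_function M Z"
    and XZ: "simple_function M XZ" and YZ: "simple_function M YZ" and XYZ: "simple_function M XYZ"
    and XZ': "\<And>\<omega> \<omega>'. \<lbrakk>\<omega> \<in> space M; \<omega>' \<in> space M\<rbrakk> \<Longrightarrow> XZ \<omega> = XZ \<omega>' \<longleftrightarrow> X \<omega> = X \<omega>' \<and> Z \<omega> = Z \<omega>'"
    and YZ': "\<And>\<omega> \<omega>'. \<lbrakk>\<omega> \<in> space M; \<omega>' \<in> space M\<rbrakk> \<Longrightarrow> YZ \<omega> = YZ \<omega>' \<longleftrightarrow> Y \<omega> = Y \<omega>' \<and> Z \<omega> = Z \<omega>'"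
    and XYZ': "\<And>\<omega> \<omega>'. \<lbrakk>\<omega> \<in> space M; \<omega>' \<in> space M\<rbrakk> \<Longrightarrow>
      XYZ \<omega> = XYZ \<omega>' \<longleftrightarrow> X \<omega> = X \<omega>' \<and> Y \<omega> = Y \<omega>' \<and> Z \<omega> = Z \<omega>'"
    and eq: "entropy 2 (count_space (XZ ` space M)) XZ + entropy 2 (count_space (YZ ` space M)) YZ
      = entropy 2 (count_space (XYZ ` space M)) XYZ + entropy 2 (count_space (Z ` space M)) Z"
  shows "prob {\<omega>\<in>space M. X \<omega> = x \<and> Y \<omega> = y \<and> Z \<omega> = z} * prob {\<omega>\<in>space M. Z \<omega> = z}
    = prob {\<omega>\<in>space M. X \<omega> = x \<and> Z \<omega> = z} * prob {\<omega>\<in>space M. Y \<omega> = y \<and> Z \<omega> = z}"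
proof -
  have sX[measurable]: "{\<omega>\<in>space M. X \<omega> = x} \<in> sets M" for x
    using simple_functionD(2)[OF X, of "{x}"] by (simp add: vimage_def Int_def conj_commute)
  have sY[measurable]: "{\<omega>\<in>space M. Y \<omega> = x} \<in> sets M" for x
    using simple_functionD(2)[OF Y, of "{x}"] by (simp add: vimage_def Int_def conj_commute)
  have sZ[measurable]: "{\<omega>\<in>space M. Z \<omega> = x} \<in> sets M" for x
    using simple_functionD(2)[OF Z, of "{x}"] by (simp add: vimage_def Int_def conj_commute)
  define pxyz where "pxyz = (\<lambda>(x, y, z). prob {\<omega>\<in>space M. X \<omega> = x \<and> Y \<omega> = y \<and> Z \<omega> = z})"
  define pxz where "pxz x z = prob {\<omega>\<in>space M. X \<omega> = x \<and> Z \<omega> = z}" for x z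
  define pyz where "pyz y z = prob {\<omega>\<in>space M. Y \<omega> = y \<and> Z \<omega> = z}" for y z
  define pz where "pz z = prob {\<omega>\<in>space M. Z \<omega> = z}" for z
  define W where "W \<omega> = (X \<omega>, Y \<omega>, Z \<omega>)" for \<omega>
  \<comment> \<open>The distribution with the same (X, Z) and (Y, Z) marginals under which X and Y
    are conditionally independent given Z. The goal amounts to \<open>pxyz\<close> =
    \<open>q\<close>.\<close>
  define q where "q = (\<lambda>(x, y, z). pxz x z * pyz y z / pz z)"
  \<comment> \<open>The full product instead of the range of \<open>W\<close>: a priori
    \<open>q\<close> may charge triples that never occur, and its total mass is computed over all of
    \<open>J\<close>.\<close>
  define J where "J = X ` space M \<times> Y ` space M \<times> Z ` space M"
  have finX: "finite (X ` space M)" and finY: "finite (Y ` space M)" and finZ: "finite (Z ` space M)"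
    using X Y Z by (auto dest: simple_functionD)
  have W: "simple_function M W"
    unfolding W_def by (intro simple_function_Pair X Y Z)
  have finJ: "finite J" using finX finY finZ by (simp add: J_def)
  have WJ: "W ` space M \<subseteq> J" by (auto simp: W_def J_def)
  have pW: "prob (W -` {j} \<inter> space M) = pxyz j" for j
    by (cases j) (auto simp: W_def pxyz_def intro!: arg_cong[where f = prob])
  have pxyz0: "pxyz j = 0" if "j \<notin> W ` space M" for j
  proof -
    have "W -` {j} \<inter> space M = {}" using that by blast
    then show ?thesis using pW[of j] by simp
  qed
  have le: "pxyz (x, y, z) \<le> pxz x z" "pxyz (x, y, z) \<le> pyz y z" "pxz x z \<le> pz z" "pyz y z \<le> pz z" for x y z
    unfolding pxyz_def pxz_def pyz_def pz_def by (auto intro!: finite_measure_mono)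
  have ge0: "0 \<le> pxyz j" "0 \<le> pxz x z" "0 \<le> pyz y z" "0 \<le> pz z" for j x y z
    unfolding pxyz_def pxz_def pyz_def pz_def by (auto split: prod.split)
  have ent: "entropy 2 (count_space (V ` space M)) V = - (\<Sum>j\<in>J. pxyz j * log 2 (m j))"
    if V: "simple_function M V"
      and m: "\<And>\<omega>. \<omega> \<in> space M \<Longrightarrow> prob {\<omega>'\<in>space M. V \<omega>' = V \<omega>} = m (W \<omega>)"
      and r: "\<And>\<omega> \<omega>'. \<lbrakk>\<omega> \<in> space M; \<omega>' \<in> space M; W \<omega> = W \<omega>'\<rbrakk> \<Longrightarrow> V \<omega> = V \<omega>'"
    for V :: "'a \<Rightarrow> 'z" and m
  proof -
    define g where "g j = V (SOME \<omega>. \<omega> \<in> space M \<and> W \<omega> = j)" for j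
    have g: "V \<omega> = g (W \<omega>)" if "\<omega> \<in> space M" for \<omega>
      using someI[of "\<lambda>\<omega>'. \<omega>' \<in> space M \<and> W \<omega>' = W \<omega>" \<omega>] that r unfolding g_def by metis
    have "entropy 2 (count_space (V ` space M)) V
        = - (\<Sum>j\<in>W ` space M. prob (W -` {j} \<inter> space M) * log 2 (prob (V -` {g j} \<inter> space M)))"
      by (rule entropy_refine[OF W V g])
    also have "(\<Sum>j\<in>W ` space M. prob (W -` {j} \<inter> space M) * log 2 (prob (V -` {g j} \<inter> space M)))
        = (\<Sum>j\<in>W ` space M. pxyz j * log 2 (m j))"
    proof (rule sum.cong[OF refl])
      fix j assume "j \<in> W ` space M"
      then obtain \<omega> where \<omega>: "\<omega> \<in> space M" "j = W \<omega>" by auto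
      have "V -` {g j} \<inter> space M = {\<omega>'\<in>space M. V \<omega>' = V \<omega>}"
        using g[OF \<omega>(1)] \<omega>(2) by auto
      then show "prob (W -` {j} \<inter> space M) * log 2 (prob (V -` {g j} \<inter> space M)) = pxyz j * log 2 (m j)"
        using pW m[OF \<omega>(1)] \<omega>(2) by simp
    qed
    also have "\<dots> = (\<Sum>j\<in>J. pxyz j * log 2 (m j))"
      by (rule sum.mono_neutral_left[OF finJ WJ]) (auto simp: pxyz0)
    finally show ?thesis .
  qed
  have eXZ: "entropy 2 (count_space (XZ ` space M)) XZ = - (\<Sum>j\<in>J. pxyz j * log 2 (case j of (x, y, z) \<Rightarrow> pxz x z))"
    by (rule ent[OF XZ]) (auto simp: W_def pxz_def XZ' cong: conj_cong intro!: arg_cong[where f = prob])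
  have eYZ: "entropy 2 (count_space (YZ ` space M)) YZ = - (\<Sum>j\<in>J. pxyz j * log 2 (case j of (x, y, z) \<Rightarrow> pyz y z))"
    by (rule ent[OF YZ]) (auto simp: W_def pyz_def YZ' cong: conj_cong intro!: arg_cong[where f = prob])
  have eZ: "entropy 2 (count_space (Z ` space M)) Z = - (\<Sum>j\<in>J. pxyz j * log 2 (case j of (x, y, z) \<Rightarrow> pz z))"
    by (rule ent[OF Z]) (auto simp: W_def pz_def)
  have eXYZ: "entropy 2 (count_space (XYZ ` space M)) XYZ = - (\<Sum>j\<in>J. pxyz j * log 2 (pxyz j))"
    by (rule ent[OF XYZ]) (auto simp: W_def pxyz_def XYZ' cong: conj_cong intro!: arg_cong[where f = prob])
  have qpos: "0 < q j" if "0 < pxyz j" for j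
  proof -
    obtain x y z where j: "j = (x, y, z)" by (cases j)
    then have "0 < pxz x z" "0 < pyz y z" "0 < pz z" using that le(1,2)[of x y z] le(3)[of x z] by auto
    then show ?thesis by (simp add: j q_def)
  qed
  have logq: "pxyz j * log 2 (q j) = pxyz j * log 2 (case j of (x, y, z) \<Rightarrow> pxz x z)
     + pxyz j * log 2 (case j of (x, y, z) \<Rightarrow> pyz y z) - pxyz j * log 2 (case j of (x, y, z) \<Rightarrow> pz z)" for j
  proof (cases "pxyz j = 0")
    case False
    obtain x y z where j: "j = (x, y, z)" by (cases j)
    have "0 < pxyz j" using False ge0 by (simp add: less_le)
    then have "0 < pxz x z" "0 < pyz y z" "0 < pz z" using le(1,2)[of x y z] le(3)[of x z] j by auto
    then show ?thesis by (simp add: j q_def log_divide_pos log_mult_pos algebra_simps)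
  qed simp
  have sumx: "(\<Sum>x\<in>X ` space M. pxz x z) = pz z" for z
    unfolding pz_def pxz_def
    by (subst prob_marginal[OF X]) (auto intro!: sum.cong arg_cong[where f = prob])
  have sumy: "(\<Sum>y\<in>Y ` space M. pyz y z) = pz z" for z
    unfolding pz_def pyz_def
    by (subst prob_marginal[OF Y]) (auto intro!: sum.cong arg_cong[where f = prob])
  have sumz: "(\<Sum>z\<in>Z ` space M. pz z) = 1"
    unfolding pz_def prob_space[symmetric]
    by (subst prob_marginal[OF Z sets.top]) (auto intro!: sum.cong arg_cong[where f = prob])
  have "sum q J = (\<Sum>x\<in>X ` space M. \<Sum>y\<in>Y ` space M. \<Sum>z\<in>Z ` space M. pxz x z * pyz y z / pz z)"
    unfolding J_def q_def by (simp add: sum.cartesian_product)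
  also have "\<dots> = (\<Sum>x\<in>X ` space M. \<Sum>z\<in>Z ` space M. \<Sum>y\<in>Y ` space M. pxz x z * pyz y z / pz z)"
    by (intro sum.cong refl sum.swap)
  also have "\<dots> = (\<Sum>z\<in>Z ` space M. \<Sum>x\<in>X ` space M. \<Sum>y\<in>Y ` space M. pxz x z * pyz y z / pz z)"
    by (rule sum.swap)
  also have "\<dots> = (\<Sum>z\<in>Z ` space M. (\<Sum>x\<in>X ` space M. pxz x z) * (\<Sum>y\<in>Y ` space M. pyz y z) / pz z)"
    by (simp add: sum_product sum_divide_distrib)
  \<comment> \<open>A term with \<open>pz z\<close> = 0 contributes 0 * 0 / 0 = 0, which is again
    \<open>pz z\<close>.\<close>
  also have "\<dots> = 1" unfolding sumx sumy using sumz by simp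
  finally have sumq: "sum q J = 1" .
  have "1 = (\<Sum>j\<in>W ` space M. pxyz j)"
    using prob_marginal[OF W sets.top] unfolding prob_space
    by (simp add: pW[symmetric] Int_absorb1 Int_commute)
  also have "\<dots> = sum pxyz J"
    by (rule sum.mono_neutral_left[OF finJ WJ]) (auto simp: pxyz0)
  finally have sump: "sum pxyz J = 1" by simp
  \<comment> \<open>By \<open>logq\<close> the entropy equation says that the entropy of
    \<open>pxyz\<close> equals its cross entropy with \<open>q\<close>: the equality case of Gibbs'
    inequality.\<close>
  have key: "pxyz (x, y, z) = q (x, y, z)" if "(x, y, z) \<in> J"
  proof (rule gibbs_equality[OF finJ _ _ _ _ _ that])
    show "0 \<le> q j" for j using ge0 by (auto simp: q_def split: prod.split)
    show "(\<Sum>j\<in>J. pxyz j * log 2 (pxyz j)) = (\<Sum>j\<in>J. pxyz j * log 2 (q j))"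
      using eq unfolding eXZ eYZ eZ eXYZ logq sum_subtractf sum.distrib by simp
  qed (use ge0 qpos sumq sump in auto)
  have "pxyz (x, y, z) * pz z = pxz x z * pyz y z"
  proof (cases "(x, y, z) \<in> J")
    case True
    then show ?thesis
      using key ge0(2)[of x z] order.antisym[of "pxz x z" 0] le(3)[of x z]
      by (cases "pz z = 0") (auto simp: q_def)
  next
    case False
    then have "pxyz (x, y, z) = 0" using WJ pxyz0 by blast
    \<comment> \<open>A value \<open>x\<close> or \<open>z\<close> out of range empties the first
      event, a value \<open>y\<close> or \<open>z\<close> out of range the second.\<close>
    moreover have "pxz x z = 0 \<or> pyz y z = 0"
    proof -
      have "{\<omega>\<in>space M. X \<omega> = x \<and> Z \<omega> = z} = {} \<or> {\<omega>\<in>space M. Y \<omega> = y \<and> Z \<omega> = z} = {}"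
        using False unfolding J_def by auto
      then show ?thesis unfolding pxz_def pyz_def
        by (elim disjE) (simp_all only: measure_empty simp_thms)
    qed
    ultimately show ?thesis by auto
  qed
  then show ?thesis by (simp add: pxyz_def pxz_def pyz_def pz_def)
qed

section \<open>Only if: the entropy identities force the value of \<open>a\<close>\<close>

lemma log_if_has_entropy_function:
  fixes M :: "'a measure" and X :: "nat \<Rightarrow> 'a \<Rightarrow> 'b"
  assumes ent: "has_entropy_function M X (face_point U_hat_1_35 U_234_13 a b)"
  shows "\<exists>v::int. v \<ge> 1 \<and> a = log 2 (real_of_int v)"
proof -
  define h where "h = face_point U_hat_1_35 U_234_13 a b"
  interpret prob_space M using ent by (simp add: has_entropy_function_def)
  have X: "simple_function M (X i)" if "i \<in> N4" for i
    using ent that unfolding has_entropy_function_def by blast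
  have h: "h A = entropy 2 (count_space (subvector X A ` space M)) (subvector X A)" if "A \<subseteq> N4" for A
    using ent that by (simp add: has_entropy_function_def h_def)
  have sX: "simple_function M (subvector X A)" if "A \<subseteq> N4" for A
    using that finite_subset[OF that] X by (intro simple_function_subvector) auto
  \<comment> \<open>One total assignment \<open>f\<close> serves all marginals, because
    \<open>P A f\<close> looks at \<open>f\<close> only on \<open>A\<close>. Fixing a further
    coordinate is then a function update.\<close>
  define P where "P A f = prob {\<omega>\<in>space M. \<forall>i\<in>A. X i \<omega> = f i}" for A and f :: "nat \<Rightarrow> 'b"
  have sub_restrict: "subvector X A \<omega> = restrict f A \<longleftrightarrow> (\<forall>i\<in>A. X i \<omega> = f i)" for A \<omega> f
    unfolding subvector_def by (auto simp: fun_eq_iff restrict_def)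
  have sub_eq: "subvector X A \<omega> = subvector X A \<omega>' \<longleftrightarrow> (\<forall>i\<in>A. X i \<omega> = X i \<omega>')" for A \<omega> \<omega>'
    unfolding subvector_def by (auto simp: fun_eq_iff restrict_def)
  have P_sub: "P A f = prob (subvector X A -` {restrict f A} \<inter> space M)" for A f
    unfolding P_def by (rule arg_cong[where f = prob]) (auto simp: sub_restrict)
  have P_sets: "{\<omega>\<in>space M. \<forall>i\<in>A. X i \<omega> = f i} \<in> sets M" if "A \<subseteq> N4" for A f
  proof -
    have "subvector X A -` {restrict f A} \<inter> space M = {\<omega>\<in>space M. \<forall>i\<in>A. X i \<omega> = f i}"
      by (auto simp: sub_restrict)
    then show ?thesis using simple_functionD(2)[OF sX[OF that], of "{restrict f A}"] by simp
  qed
  have P_nonneg: "0 \<le> P A f" for A f by (simp add: P_def)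
  have P_cong: "P A f = P A g" if "\<And>i. i \<in> A \<Longrightarrow> f i = g i" for A f g
    using that by (simp add: P_def cong: conj_cong)
  have P_empty: "P {} f = 1" for f by (simp add: P_def prob_space)
  have P_sum: "P A f = (\<Sum>y\<in>X i ` space M. P (insert i A) (f(i := y)))"
    if "A \<subseteq> N4" "i \<in> N4" "i \<notin> A" for A f i
    unfolding P_def prob_marginal[OF X[OF that(2)] P_sets[OF that(1)]]
    using that(3) by (auto intro!: sum.cong arg_cong[where f = prob])
  have P_extend: "\<exists>y\<in>X i ` space M. 0 < P (insert i A) (f(i := y))"
    if "A \<subseteq> N4" "i \<in> N4" "i \<notin> A" "0 < P A f" for A f i
  proof (rule ccontr)
    assume "\<not> ?thesis"
    then have "\<forall>y\<in>X i ` space M. P (insert i A) (f(i := y)) = 0"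
      using P_nonneg by (metis less_le)
    then have "P A f = 0" unfolding P_sum[OF that(1-3)] by (intro sum.neutral) simp
    then show False using that(4) by simp
  qed
  \<comment> \<open>The sets may overlap or be empty: \<open>C = {}\<close> yields independence, and
    \<open>A = B\<close> yields that \<open>C\<close> determines \<open>A\<close>. The unions carry
    their own names so that instances speak of literal sets.\<close>
  have ci: "P ABC f * P C f = P AC f * P BC f"
    if sets: "A \<union> C = AC" "B \<union> C = BC" "A \<union> B \<union> C = ABC" "ABC \<subseteq> N4"
      and eq: "h AC + h BC = h ABC + h C" for A B C AC BC ABC f
  proof -
    have s: "A \<subseteq> N4" "B \<subseteq> N4" "C \<subseteq> N4" "AC \<subseteq> N4" "BC \<subseteq> N4" using sets by auto
    have "prob {\<omega>\<in>space M. subvector X A \<omega> = restrict f A \<and> subvector X B \<omega> = restrict f B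
           \<and> subvector X C \<omega> = restrict f C}
        * prob {\<omega>\<in>space M. subvector X C \<omega> = restrict f C}
      = prob {\<omega>\<in>space M. subvector X A \<omega> = restrict f A \<and> subvector X C \<omega> = restrict f C}
        * prob {\<omega>\<in>space M. subvector X B \<omega> = restrict f B \<and> subvector X C \<omega> = restrict f C}"
    proof (rule conditional_indep_of_entropy_eq[OF sX sX sX sX sX sX])
      show "A \<subseteq> N4" "B \<subseteq> N4" "C \<subseteq> N4" "AC \<subseteq> N4" "BC \<subseteq> N4" "ABC \<subseteq> N4"
        by fact+
    qed (use eq s sets in \<open>auto simp: sub_eq h\<close>)
    then show ?thesis
      unfolding sub_restrict P_def sets(1,2,3)[symmetric] by (simp add: ball_Un conj_assoc)
  qed
  note h_eval = h_def face_point_def U_hat_1_35_def U_234_13_def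
  \<comment> \<open>The case \<open>C = {}\<close>; the identity is 2a + (a + b) = 3a + b.\<close>
  have ind: "P {1, i} f = P {1} f * P {i} f" if "i \<in> {2, 3, 4}" for i f
    using ci[of "{1}" "{}" "{1}" "{i}" "{i}" "{1, i}" f] that
    by (auto simp: h_eval P_empty insert_commute)
  have det: "P N4 f = P {1, i} f" if "i \<in> {2, 3, 4}" "0 < P N4 f" for i f
  proof -
    have s: "N4 \<union> {1, i} = N4" "N4 \<union> N4 \<union> {1, i} = N4" using that(1) by auto
    \<comment> \<open>Both \<open>N4\<close> and \<open>{1, i}\<close> have entropy 3a + b. With
      \<open>N4\<close> for both \<open>A\<close> and \<open>B\<close>, \<open>ci\<close> equates
      \<open>P N4 f * P {1, i} f\<close> with the square of \<open>P N4 f\<close>, and the positive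
      factor cancels. The set \<open>{2, 3, 4}\<close>, also of entropy 3a + b, is treated alike
      below.\<close>
    have "h N4 + h N4 = h N4 + h {1, i}" using that(1) by (auto simp: h_eval)
    from ci[OF s(1) s(1) s(2) order.refl this, of f] show ?thesis using that(2) by simp
  qed
  have det234: "P N4 f = P {2, 3, 4} f" if "0 < P N4 f" for f
  proof -
    have s: "N4 \<union> {2, 3, 4} = N4" "N4 \<union> N4 \<union> {2, 3, 4} = N4" by auto
    have "h N4 + h N4 = h N4 + h {2, 3, 4}" by (simp add: h_eval)
    from ci[OF s(1) s(1) s(2) order.refl this, of f] show ?thesis using that by simp
  qed
  \<comment> \<open>The identity is 2(2a + b) = (3a + b) + (a + b), and likewise for
    \<open>ci3\<close> and \<open>ci4\<close>.\<close>
  have ci2: "P {2, 3, 4} f * P {2} f = P {2, 3} f * P {2, 4} f" for f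
  proof (rule ci)
    show "{3} \<union> {2} = {2, 3}" "{4} \<union> {2} = {2, 4}" "{3} \<union> {4} \<union> {2} = {2, 3, 4 :: nat}"
      by auto
    show "h {2, 3} + h {2, 4} = h {2, 3, 4} + h {2}" by (simp add: h_eval)
  qed simp
  have ci3: "P {2, 3, 4} f * P {3} f = P {2, 3} f * P {3, 4} f" for f
  proof (rule ci)
    show "{2} \<union> {3} = {2, 3}" "{4} \<union> {3} = {3, 4}" "{2} \<union> {4} \<union> {3} = {2, 3, 4 :: nat}"
      by auto
    show "h {2, 3} + h {3, 4} = h {2, 3, 4} + h {3}" by (simp add: h_eval)
  qed simp
  have ci4: "P {2, 3, 4} f * P {4} f = P {2, 4} f * P {3, 4} f" for f
  proof (rule ci)
    show "{2} \<union> {4} = {2, 4}" "{3} \<union> {4} = {3, 4}" "{2} \<union> {3} \<union> {4} = {2, 3, 4 :: nat}"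
      by auto
    show "h {2, 4} + h {3, 4} = h {2, 3, 4} + h {4}" by (simp add: h_eval)
  qed simp
  have atom: "P {2, 3} f = P {2, 4} f" "P {1} f = (P {2, 3} f / P {2} f)\<^sup>2"
    if pos: "0 < P N4 f" for f
  proof -
    have m: "P N4 f = P {1} f * P {i} f" if "i \<in> {2, 3, 4}" for i
      using det[OF that pos] ind[OF that] by simp
    have p1: "0 < P {1} f" and p2: "0 < P {2} f"
      using m[of 2] pos P_nonneg[of "{1}" f] P_nonneg[of "{2}" f] by (auto simp: less_le)
    have p: "P {3} f = P {2} f" "P {4} f = P {2} f"
      using m[of 2] m[of 3] m[of 4] p1 by auto
    have e: "P {2, 3, 4} f = P {1} f * P {2} f" using det234[OF pos] m[of 2] by simp
    \<comment> \<open>This is the common factor on the right of \<open>ci3\<close> and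
      \<open>ci4\<close>. Their left sides agree since \<open>P {3} f\<close> =
      \<open>P {4} f\<close>, so cancelling it equates \<open>P {2, 3} f\<close> and
      \<open>P {2, 4} f\<close>.\<close>
    have nz: "P {3, 4} f \<noteq> 0" using ci3[of f] e p p1 p2 by auto
    show *: "P {2, 3} f = P {2, 4} f" using ci3[of f] ci4[of f] p nz by simp
    show "P {1} f = (P {2, 3} f / P {2} f)\<^sup>2"
      using ci2[of f] e * p2 by (simp add: power2_eq_square field_simps)
  qed
  \<comment> \<open>\<open>atom\<close> speaks of full assignments of positive probability, so a
    compatible value of \<open>X 1\<close> has to be adjoined.\<close>
  have to_atom: "\<exists>g. (\<forall>i\<in>{2, 3, 4}. g i = f i) \<and> 0 < P N4 g" if pos: "0 < P {2, 3, 4} f" for f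
  proof -
    obtain y where "0 < P (insert 1 {2, 3, 4}) (f(1 := y))"
      using P_extend[of "{2, 3, 4}" 1 f] pos by auto
    then show ?thesis by (intro exI[of _ "f(1 := y)"]) simp
  qed
  obtain f0 where f0: "0 < P {2} f0"
    using P_extend[of "{}" 2 "\<lambda>_. undefined"] P_empty by auto
  \<comment> \<open>The values of \<open>X 3\<close> compatible with the fixed value
    \<open>f0 2\<close> of \<open>X 2\<close>; the cardinality of this set will be the integer
    v.\<close>
  define B where "B = {y \<in> X 3 ` space M. 0 < P {2, 3} (f0(3 := y))}"
  have finB: "finite B" using simple_functionD(1)[OF X[of 3]] by (simp add: B_def)
  have "\<exists>y\<in>X 4 ` space M. 0 < P {2, 4} (f0(4 := y))"
    using P_extend[of "{2}" 4 f0] f0 by (simp add: insert_commute)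
  then obtain z where z: "0 < P {2, 4} (f0(4 := z))" by blast
  \<comment> \<open>One compatible value \<open>z\<close> of \<open>X 4\<close> serves as reference.
    By \<open>ci2\<close> it occurs jointly with every \<open>y\<close> in \<open>B\<close>, and
    \<open>atom\<close> then equates the two pair probabilities.\<close>
  define r where "r = P {2, 4} (f0(4 := z))"
  have qB: "P {2, 3} (f0(3 := y)) = r" if "y \<in> B" for y
  proof -
    let ?f = "f0(3 := y, 4 := z)"
    have e: "P {2, 3} ?f = P {2, 3} (f0(3 := y))" "P {2, 4} ?f = P {2, 4} (f0(4 := z))"
      "P {2} ?f = P {2} f0"
      by (rule P_cong; auto)+
    have "0 < P {2, 3} ?f * P {2, 4} ?f" using that z unfolding e B_def by simp
    then have "0 < P {2, 3, 4} ?f"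
      using ci2[of ?f] P_nonneg[of "{2, 3, 4}" ?f] by (auto simp: less_le)
    then obtain g where g: "\<forall>i\<in>{2, 3, 4}. g i = ?f i" "0 < P N4 g" using to_atom by blast
    have "P {2, 3} g = P {2, 3} ?f" "P {2, 4} g = P {2, 4} ?f"
      by (rule P_cong; use g(1) in auto)+
    then show ?thesis using atom(1)[OF g(2)] e unfolding r_def by simp
  qed
  have "P {2} f0 = (\<Sum>y\<in>X 3 ` space M. P {2, 3} (f0(3 := y)))"
    using P_sum[of "{2}" 3 f0] by (simp add: insert_commute)
  also have "\<dots> = (\<Sum>y\<in>B. P {2, 3} (f0(3 := y)))"
    using simple_functionD(1)[OF X[of 3]] P_nonneg
    by (intro sum.mono_neutral_right) (auto simp: B_def less_le)
  also have "\<dots> = card B * r" using qB by simp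
  \<comment> \<open>So each \<open>y\<close> in \<open>B\<close> has conditional probability
    \<open>r / P {2} f0\<close> = 1 / \<open>card B\<close>.\<close>
  finally have p2: "P {2} f0 = card B * r" .
  then have n: "card B > 0" and r: "r \<noteq> 0" using f0 by (auto intro: Nat.gr0I)
  have p1: "P {1} f = 1 / (real (card B))\<^sup>2" if "0 < P {1} f" for f
  proof -
    let ?f = "f0(1 := f 1)"
    have e: "P {1} ?f = P {1} f" "P {2} ?f = P {2} f0" by (rule P_cong; auto)+
    \<comment> \<open>By independence every possible value of \<open>X 1\<close> occurs with the
      same fixed value of \<open>X 2\<close>, so the single set \<open>B\<close> determines all
      probabilities of \<open>X 1\<close>.\<close>
    have "0 < P {1, 2} ?f" using ind[of 2 ?f] e that f0 by simp
    then obtain y where "0 < P (insert 3 {1, 2}) (?f(3 := y))"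
      using P_extend[of "{1, 2}" 3 ?f] by auto
    then obtain y' where "0 < P (insert 4 (insert 3 {1, 2})) (?f(3 := y, 4 := y'))"
      using P_extend[of "insert 3 {1, 2}" 4 "?f(3 := y)"] by auto
    then have pos: "0 < P N4 (?f(3 := y, 4 := y'))" (is "0 < P N4 ?g")
      by (simp add: insert_commute)
    have e': "P {1} ?g = P {1} f" "P {2} ?g = P {2} f0" "P {2, 3} ?g = P {2, 3} (f0(3 := y))"
      by (rule P_cong; auto)+
    have a2: "P {1} f = (P {2, 3} (f0(3 := y)) / P {2} f0)\<^sup>2" using atom(2)[OF pos] e' by simp
    then have "0 < P {2, 3} (f0(3 := y))"
      using that P_nonneg[of "{2, 3}" "f0(3 := y)"] by (auto simp: less_le)
    moreover have "y \<in> X 3 ` space M"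
    proof (rule ccontr)
      assume "y \<notin> X 3 ` space M"
      then have "{\<omega>\<in>space M. \<forall>i\<in>{2, 3}. X i \<omega> = (f0(3 := y)) i} = {}" by auto
      then have "P {2, 3} (f0(3 := y)) = 0" unfolding P_def by (simp only: measure_empty)
      then show False using calculation by simp
    qed
    ultimately have "y \<in> B" by (simp add: B_def)
    then have "P {1} f = (r / (card B * r))\<^sup>2" using a2 qB p2 by simp
    also have "r / (card B * r) = 1 / card B" using r by simp
    finally show ?thesis by (simp add: power_divide)
  qed
  let ?Y = "subvector X {1}"
  have sY: "simple_function M ?Y" by (rule sX) simp
  have "prob (?Y -` {y} \<inter> space M) * log 2 (prob (?Y -` {y} \<inter> space M))
      = prob (?Y -` {y} \<inter> space M) * log 2 (1 / (real (card B))\<^sup>2)" if "y \<in> ?Y ` space M" for y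
  proof -
    have "restrict y {1} = y" using that by (auto simp: subvector_def)
    then have e: "prob (?Y -` {y} \<inter> space M) = P {1} y" by (simp only: P_sub)
    show ?thesis
    proof (cases "P {1} y = 0")
      case True
      then show ?thesis unfolding e by (simp only: mult_zero_left)
    next
      case False
      then have pos: "0 < P {1} y" using P_nonneg by (simp only: less_le simp_thms not_sym)
      show ?thesis unfolding e p1[OF pos] ..
    qed
  qed
  \<comment> \<open>The logarithm is constant on the range of \<open>X 1\<close>, so it factors out
    and the probabilities add up to 1.\<close>
  then have "(\<Sum>y\<in>?Y ` space M. prob (?Y -` {y} \<inter> space M) * log 2 (prob (?Y -` {y} \<inter> space M)))
      = (\<Sum>y\<in>?Y ` space M. prob (?Y -` {y} \<inter> space M)) * log 2 (1 / (real (card B))\<^sup>2)"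
    unfolding sum_distrib_right by (rule sum.cong[OF refl])
  also have "(\<Sum>y\<in>?Y ` space M. prob (?Y -` {y} \<inter> space M)) = 1"
    unfolding prob_space[symmetric]
    by (subst prob_marginal[OF sY sets.top]) (auto intro!: sum.cong arg_cong[where f = prob])
  finally have "h {1} = - log 2 (1 / (real (card B))\<^sup>2)"
    using h[of "{1}"] entropy_simple_function[OF prob_space_axioms sY] by simp
  also have "\<dots> = 2 * log 2 (real (card B))"
    using n by (simp add: log_divide_pos log_nat_power)
  also have "h {1} = 2 * a" by (simp add: h_eval)
  finally have "a = log 2 (real_of_int (int (card B)))" by simp
  then show ?thesis using n by (intro exI[of _ "int (card B)"]) simp
qed

section \<open>A finite distribution of prescribed entropy\<close>

text \<open>At 0 the value of the function is 0, which is also its limit from the right. This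
  endpoint matters because the path of distributions starts at a point mass.\<close>

lemma continuous_on_mult_log: "continuous_on {0..} (\<lambda>x::real. x * log 2 x)"
proof (rule continuous_on_eq_continuous_within[THEN iffD2], rule ballI)
  fix x :: real assume "x \<in> {0..}"
  show "continuous (at x within {0..}) (\<lambda>x::real. x * log 2 x)"
  proof (cases "x = 0")
    case True
    have "((\<lambda>x::real. x * log 2 x) \<longlongrightarrow> 0) (at_right 0)" by real_asymp
    then show ?thesis using True by (simp add: continuous_within at_within_Ici_at_right)
  next
    case False
    then show ?thesis using \<open>x \<in> {0..}\<close> by (auto intro!: continuous_intros)
  qed
qed

text \<open>Intermediate value theorem along the distributions with one weight \<open>1 - m s\<close> and \<open>m\<close> weights
  \<open>s\<close>, from a point mass to the uniform one.\<close>

lemma exists_distribution_with_entropy: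
  fixes b :: real
  assumes "0 \<le> b"
  obtains m :: nat and w :: "nat \<Rightarrow> real"
  where "\<And>i. 0 \<le> w i" "(\<Sum>i\<le>m. w i) = 1" "- (\<Sum>i\<le>m. w i * log 2 (w i)) = b"
proof -
  \<comment> \<open>Large enough for the uniform distribution on \<open>m + 1\<close> points to have
    entropy at least \<open>b\<close>.\<close>
  define m where "m = nat \<lceil>2 powr b\<rceil>"
  define f where "f s = - ((1 - m * s) * log 2 (1 - m * s) + m * (s * log 2 s))" for s :: real
  have m: "2 powr b \<le> real m + 1" unfolding m_def by linarith
  have "\<exists>s\<ge>0. s \<le> 1 / (real m + 1) \<and> f s = b"
  proof (rule IVT')
    show "f 0 \<le> b" using assms by (simp add: f_def)
    have "b = log 2 (2 powr b)" by simp
    also have "\<dots> \<le> log 2 (real m + 1)" using m by (subst log_le_cancel_iff) auto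
    also have "\<dots> = f (1 / (real m + 1))"
    proof -
      have e: "1 - real m * (1 / (real m + 1)) = 1 / (real m + 1)" by (simp add: field_simps)
      have "f (1 / (real m + 1)) = - ((real m + 1) * (1 / (real m + 1) * log 2 (1 / (real m + 1))))"
        unfolding f_def e by (simp only: distrib_right mult_1_left add.commute)
      also have "\<dots> = - log 2 (1 / (real m + 1))" by (simp add: field_simps)
      also have "\<dots> = log 2 (real m + 1)" by (simp add: log_divide_pos)
      finally show ?thesis by simp
    qed
    finally show "b \<le> f (1 / (real m + 1))" .
    \<comment> \<open>Keeps the argument of \<open>continuous_on_mult_log\<close> in the nonnegative
      reals along the whole path.\<close>
    have ms: "0 \<le> 1 - real m * s" if "s \<in> {0..1 / (real m + 1)}" for s
    proof -
      have "s * (real m + 1) \<le> 1" "0 \<le> s" using that by (auto simp: field_simps)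
      then show ?thesis by (simp add: algebra_simps)
    qed
    show "continuous_on {0..1 / (real m + 1)} f"
      unfolding f_def
      by (intro continuous_intros continuous_on_compose2[OF continuous_on_mult_log, of _ "\<lambda>s. 1 - real m * s"]
            continuous_on_subset[OF continuous_on_mult_log]) (use ms in auto)
  qed simp
  then obtain s where s: "0 \<le> s" "s \<le> 1 / (real m + 1)" "f s = b" by blast
  \<comment> \<open>The heavy weight sits at index 0; the remaining \<open>m\<close> of the
    \<open>m + 1\<close> indices carry \<open>s\<close>.\<close>
  define w where "w i = (if i = 0 then 1 - m * s else s)" for i :: nat
  have sum_w: "(\<Sum>i\<le>m. g (w i)) = g (1 - m * s) + m * g s" for g :: "real \<Rightarrow> real"
  proof -
    have "(\<Sum>i\<le>m. g (w i)) = g (w 0) + (\<Sum>i\<in>{1..m}. g (w i))"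
      by (simp add: sum.atLeast_Suc_atMost atMost_atLeast0)
    also have "(\<Sum>i\<in>{1..m}. g (w i)) = (\<Sum>i\<in>{1..m}. g s)"
      by (rule sum.cong) (auto simp: w_def)
    finally show ?thesis by (simp add: w_def)
  qed
  show thesis
  proof
    have "s * (real m + 1) \<le> 1" using s(2) by (simp add: field_simps)
    then show "0 \<le> w i" for i using s(1) by (simp add: w_def algebra_simps)
    show "(\<Sum>i\<le>m. w i) = 1" using sum_w[of "\<lambda>x. x"] by simp
    show "- (\<Sum>i\<le>m. w i * log 2 (w i)) = b" using sum_w[of "\<lambda>x. x * log 2 x"] s(3) by (simp add: f_def)
  qed
qed

section \<open>A uniform variable paired with an independent one\<close>

text \<open>\<open>U\<close> will carry the three residues modulo v, and \<open>G\<close> the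
  independent variable of entropy \<open>b\<close>.\<close>

definition uniform_product :: "'u set \<Rightarrow> 'g set \<Rightarrow> ('g \<Rightarrow> real) \<Rightarrow> ('u \<times> 'g) measure" where
  "uniform_product U G w = point_measure (U \<times> G) (\<lambda>(u, g). w g / card U)"

context
  fixes U :: "'u set" and G :: "'g set" and w :: "'g \<Rightarrow> real"
  assumes finU: "finite U" and U: "U \<noteq> {}" and finG: "finite G"
    and w: "\<And>g. 0 \<le> w g" and sum_w: "sum w G = 1"
begin

lemma measure_uniform_product:
  assumes "C \<subseteq> U" "D \<subseteq> G"
  shows "measure (uniform_product U G w) (C \<times> D) = card C / card U * sum w D"
proof -
  have "measure (uniform_product U G w) (C \<times> D) = (\<Sum>(u, g)\<in>C \<times> D. w g / card U)"
    unfolding uniform_product_def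
    using finU finG w assms by (subst measure_point_measure_finite_if) auto
  also have "\<dots> = card C / card U * sum w D"
    by (simp add: sum.cartesian_product[symmetric] sum_divide_distrib[symmetric])
  finally show ?thesis .
qed

lemma space_uniform_product: "space (uniform_product U G w) = U \<times> G"
  by (simp add: uniform_product_def space_point_measure)

lemma simple_function_uniform_product: "simple_function (uniform_product U G w) f"
  using finU finG by (simp add: uniform_product_def)

lemma prob_space_uniform_product: "prob_space (uniform_product U G w)"
proof
  interpret finite_measure "uniform_product U G w"
    unfolding uniform_product_def
    using finU finG by (intro finite_measureI) (auto simp: emeasure_point_measure_finite space_point_measure)
  have "measure (uniform_product U G w) (U \<times> G) = 1"
    using finU U by (simp add: measure_uniform_product sum_w)
  then show "emeasure (uniform_product U G w) (space (uniform_product U G w)) = 1"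
    by (simp add: emeasure_eq_measure space_uniform_product)
qed

text \<open>The probability of a level set splits into a constant \<open>c\<close> from the uniform
  factor and a part \<open>m g\<close>, so its logarithm splits too. The two uses are
  \<open>m\<close> = 1, when \<open>Y\<close> ignores the second coordinate, and \<open>m\<close> =
  \<open>w\<close>, when \<open>Y\<close> determines it; zeros of \<open>w\<close> are allowed
  for.\<close>

lemma entropy_uniform_product:
  assumes "\<And>u g. u \<in> U \<Longrightarrow> g \<in> G \<Longrightarrow>
    measure (uniform_product U G w) {t \<in> U \<times> G. Y t = Y (u, g)} = c * m g"
    and c: "0 < c" and m: "\<And>g. g \<in> G \<Longrightarrow> 0 < w g \<Longrightarrow> 0 < m g"
  shows "prob_space.entropy (uniform_product U G w) 2 (count_space (Y ` (U \<times> G))) Y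
    = - log 2 c - (\<Sum>g\<in>G. w g * log 2 (m g))"
proof -
  interpret prob_space "uniform_product U G w" by (rule prob_space_uniform_product)
  have card: "card U > 0" using finU U by (simp add: card_gt_0_iff)
  have "entropy 2 (count_space (Y ` space (uniform_product U G w))) Y
      = - (\<Sum>t\<in>id ` (U \<times> G). prob (id -` {t} \<inter> (U \<times> G)) * log 2 (prob (Y -` {Y t} \<inter> (U \<times> G))))"
    unfolding space_uniform_product[symmetric]
    by (rule entropy_refine) (auto simp: simple_function_uniform_product)
  also have "\<dots> = - (\<Sum>(u, g)\<in>U \<times> G. w g / card U * (log 2 c + log 2 (m g)))"
  proof (intro arg_cong[where f = uminus] sum.cong)
    fix t assume "t \<in> U \<times> G"
    then obtain u g where t: "t = (u, g)" and ug: "u \<in> U" "g \<in> G" by blast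
    have "id -` {(u, g)} \<inter> (U \<times> G) = {u} \<times> {g}" using ug by auto
    then have "prob (id -` {(u, g)} \<inter> (U \<times> G)) = w g / card U"
      using measure_uniform_product[of "{u}" "{g}"] ug by simp
    moreover have "Y -` {Y (u, g)} \<inter> (U \<times> G) = {t \<in> U \<times> G. Y t = Y (u, g)}" by auto
    \<comment> \<open>Where \<open>w g\<close> = 0 the logarithm need not split, but the weight in
      front of it vanishes.\<close>
    moreover have "w g = 0 \<or> log 2 (c * m g) = log 2 c + log 2 (m g)"
    proof (cases "w g = 0")
      case False
      then have "0 < w g" using w by (simp add: less_le)
      then show ?thesis using c m[OF ug(2)] by (simp add: log_mult_pos)
    qed simp
    ultimately show "prob (id -` {t} \<inter> (U \<times> G)) * log 2 (prob (Y -` {Y t} \<inter> (U \<times> G)))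
        = (case t of (u, g) \<Rightarrow> w g / card U * (log 2 c + log 2 (m g)))"
      using assms(1)[OF ug] unfolding t by auto
  qed simp
  also have "(\<Sum>(u, g)\<in>U \<times> G. w g / card U * (log 2 c + log 2 (m g)))
      = (\<Sum>g\<in>G. w g * (log 2 c + log 2 (m g)))"
    using card by (simp add: sum.cartesian_product[symmetric] sum_divide_distrib[symmetric])
  also have "\<dots> = log 2 c + (\<Sum>g\<in>G. w g * log 2 (m g))"
    by (simp add: distrib_left sum.distrib sum_distrib_right[symmetric] sum_w)
  finally show ?thesis by (simp add: space_uniform_product)
qed

lemma entropy_uniform_product_independent:
  assumes "\<And>u g. u \<in> U \<Longrightarrow> g \<in> G \<Longrightarrow>
      {t \<in> U \<times> G. Y t = Y (u, g)} = C u \<times> G \<and> C u \<subseteq> U \<and> card (C u) = k"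
    and k: "0 < k"
  shows "prob_space.entropy (uniform_product U G w) 2 (count_space (Y ` (U \<times> G))) Y
    = log 2 (card U) - log 2 k"
proof -
  have card: "card U > 0" using finU U by (simp add: card_gt_0_iff)
  have "prob_space.entropy (uniform_product U G w) 2 (count_space (Y ` (U \<times> G))) Y
      = - log 2 (k / card U) - (\<Sum>g\<in>G. w g * log 2 1)"
    using card k by (intro entropy_uniform_product) (simp_all add: assms(1) measure_uniform_product sum_w)
  then show ?thesis using card k by (simp add: log_divide_pos)
qed

lemma entropy_uniform_product_dependent:
  assumes "\<And>u g. u \<in> U \<Longrightarrow> g \<in> G \<Longrightarrow>
      {t \<in> U \<times> G. Y t = Y (u, g)} = C u \<times> {g} \<and> C u \<subseteq> U \<and> card (C u) = k"
    and k: "0 < k"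
  shows "prob_space.entropy (uniform_product U G w) 2 (count_space (Y ` (U \<times> G))) Y
    = log 2 (card U) - log 2 k - (\<Sum>g\<in>G. w g * log 2 (w g))"
proof -
  have card: "card U > 0" using finU U by (simp add: card_gt_0_iff)
  have "prob_space.entropy (uniform_product U G w) 2 (count_space (Y ` (U \<times> G))) Y
      = - log 2 (k / card U) - (\<Sum>g\<in>G. w g * log 2 (w g))"
    using card k by (intro entropy_uniform_product) (simp_all add: assms(1) measure_uniform_product)
  then show ?thesis using card k by (simp add: log_divide_pos)
qed

end

section \<open>If: the construction from residues modulo v\<close>

text \<open>Solving for either term lets the level sets of the difference variable
  \<open>X 1\<close> be described from whichever residue is known.\<close>

lemma diff_mod_eq_iff:
  fixes v :: int
  assumes "0 \<le> x" "x < v" "0 \<le> y" "y < v"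
  shows "(x - y) mod v = d mod v \<longleftrightarrow> x = (d + y) mod v"
    and "(x - y) mod v = d mod v \<longleftrightarrow> y = (x - d) mod v"
proof -
  have x: "x mod v = x" and y: "y mod v = y" using assms by simp_all
  show "(x - y) mod v = d mod v \<longleftrightarrow> x = (d + y) mod v"
  proof
    assume "(x - y) mod v = d mod v"
    then have "((x - y) mod v + y) mod v = (d mod v + y) mod v" by simp
    then show "x = (d + y) mod v" using x by (simp add: mod_simps)
  qed (simp add: mod_simps)
  show "(x - y) mod v = d mod v \<longleftrightarrow> y = (x - d) mod v"
  proof
    assume "(x - y) mod v = d mod v"
    then have "(x - (x - y) mod v) mod v = (x - d mod v) mod v" by simp
    then show "y = (x - d) mod v" using y by (simp add: mod_simps)
  qed (simp add: mod_simps)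
qed

lemma entropic_if_log:
  fixes v :: int
  assumes v: "v \<ge> 1" and a: "a = log 2 (real_of_int v)" and b: "0 \<le> b"
  shows "entropic (face_point U_hat_1_35 U_234_13 a b)"
proof -
  obtain m :: nat and w where w: "\<And>i. 0 \<le> w i" "(\<Sum>i\<le>m. w i) = 1"
    and ent_w: "- (\<Sum>i\<le>m. w i * log 2 (w i)) = b"
    using exists_distribution_with_entropy[OF b] by metis
  define V where "V = {0..<v}"
  define U where "U = V \<times> V \<times> V"
  define G where "G = {..m}"
  define M where "M = uniform_product U G w"
  \<comment> \<open>The conversion \<open>int g\<close> gives all four variables the same value
    type, pairs of integers.\<close>
  define X where "X i = (\<lambda>((x, y, z), g). if i = 1 then ((x - y) mod v, (y - z) mod v)
      else if i = 2 then (x, int g) else if i = 3 then (y, int g) else (z, int g))" for i :: nat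
  have card_V: "card V = nat v" by (simp add: V_def)
  have card_U: "card U = nat v ^ 3" by (simp add: U_def card_cartesian_product card_V power3_eq_cube)
  have "finite U" "U \<noteq> {}" "finite G" using v by (auto simp: U_def V_def G_def)
  moreover have "sum w G = 1" using w(2) by (simp add: G_def)
  ultimately have prod: "finite U" "U \<noteq> {}" "finite G" "\<And>g. 0 \<le> w g" "sum w G = 1"
    using w(1) by auto
  have sp: "space M = U \<times> G" unfolding M_def by (rule space_uniform_product[OF prod])
  have nv: "0 < nat v" "real (nat v) = real_of_int v" using v by auto
  have log_v: "log 2 (real (nat v) ^ k) = k * a" for k :: nat
    using nv by (simp add: log_nat_power a)
  have sub_eq: "subvector X A t = subvector X A t' \<longleftrightarrow> (\<forall>i\<in>A. X i t = X i t')" for A t t'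
    unfolding subvector_def by (auto simp: fun_eq_iff restrict_def)
  \<comment> \<open>Here \<open>k\<close> counts the degrees of freedom left in the three residues
    once \<open>X\<close> is seen on \<open>A\<close>; each of them lowers the entropy by
    \<open>a\<close>. The summand \<open>b\<close> appears exactly when \<open>g\<close> is seen,
    which separates this from \<open>ent_ind\<close>.\<close>
  have ent_dep: "prob_space.entropy M 2 (count_space (subvector X A ` space M)) (subvector X A) = (3 - real k) * a + b"
    if "\<And>u g. u \<in> U \<Longrightarrow> g \<in> G \<Longrightarrow>
      {t \<in> U \<times> G. \<forall>i\<in>A. X i t = X i (u, g)} = C u \<times> {g} \<and> C u \<subseteq> U \<and> card (C u) = nat v ^ k" for A C k
  proof -
    have "prob_space.entropy M 2 (count_space (subvector X A ` space M)) (subvector X A)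
        = log 2 (card U) - log 2 (nat v ^ k) - (\<Sum>g\<in>G. w g * log 2 (w g))"
      unfolding sp unfolding M_def
      by (rule entropy_uniform_product_dependent[OF prod, where C = C])
        (use that nv in \<open>simp_all add: sub_eq\<close>)
    then show ?thesis using ent_w by (simp add: card_U log_v G_def algebra_simps)
  qed
  have ent_ind: "prob_space.entropy M 2 (count_space (subvector X A ` space M)) (subvector X A) = (3 - real k) * a"
    if "\<And>u g. u \<in> U \<Longrightarrow> g \<in> G \<Longrightarrow>
      {t \<in> U \<times> G. \<forall>i\<in>A. X i t = X i (u, g)} = C u \<times> G \<and> C u \<subseteq> U \<and> card (C u) = nat v ^ k" for A C k
  proof -
    have "prob_space.entropy M 2 (count_space (subvector X A ` space M)) (subvector X A)
        = log 2 (card U) - log 2 (nat v ^ k)"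
      unfolding sp unfolding M_def
      by (rule entropy_uniform_product_independent[OF prod, where C = C])
        (use that nv in \<open>simp_all add: sub_eq\<close>)
    then show ?thesis by (simp add: card_U log_v algebra_simps)
  qed
  \<comment> \<open>The two difference equations solved starting from the middle, the first and the
    last residue, respectively.\<close>
  have X1: "X 1 ((x', y', z'), g') = X 1 ((x, y, z), g) \<longleftrightarrow> x' = (x - y + y') mod v \<and> z' = (y' - (y - z)) mod v"
    "X 1 ((x', y', z'), g') = X 1 ((x, y, z), g) \<longleftrightarrow> y' = (x' - (x - y)) mod v \<and> z' = (y' - (y - z)) mod v"
    "X 1 ((x', y', z'), g') = X 1 ((x, y, z), g) \<longleftrightarrow> x' = (x - y + y') mod v \<and> y' = (y - z + z') mod v"
    if "(x', y', z') \<in> U" for x y z g x' y' z' g'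
    using that diff_mod_eq_iff[of x' v y' "x - y"] diff_mod_eq_iff[of y' v z' "y - z"]
    by (simp_all add: X_def U_def V_def)
  note h_eval = face_point_def U_hat_1_35_def U_234_13_def
  have "face_point U_hat_1_35 U_234_13 a b A
      = prob_space.entropy M 2 (count_space (subvector X A ` space M)) (subvector X A)"
    if A: "A \<subseteq> N4" for A
  proof -
    consider "A = {}" | "A = {1}" | i where "1 \<in> A" "i \<in> A" "i \<in> {2, 3, 4}" | "A \<noteq> {}" "1 \<notin> A"
      using A by blast
    then show ?thesis
    proof cases
      case 1
      have "prob_space.entropy M 2 (count_space (subvector X A ` space M)) (subvector X A) = (3 - real 3) * a"
        by (rule ent_ind[where C = "\<lambda>_. U"]) (auto simp: 1 card_U)
      then show ?thesis by (simp add: 1 h_eval)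
    next
      case 2
      \<comment> \<open>Fixing both differences leaves the simultaneous translates of the triple,
        parametrised by the middle residue \<open>j\<close>. There are v of them, hence
        \<open>k\<close> = 1.\<close>
      define C where "C = (\<lambda>(x, y, z). (\<lambda>j. ((x - y + j) mod v, j, (j - (y - z)) mod v)) ` V)"
      have "prob_space.entropy M 2 (count_space (subvector X A ` space M)) (subvector X A) = (3 - real 1) * a"
      proof (rule ent_ind[where C = C])
        fix u g assume ug: "u \<in> U" "g \<in> G"
        obtain x y z where u: "u = (x, y, z)" by (cases u)
        have sub: "C u \<subseteq> U" using v by (auto simp: C_def u U_def V_def)
        have "card (C u) = nat v ^ 1"
          unfolding C_def u prod.case by (subst card_image) (auto simp: inj_on_def card_V)
        moreover have "{t \<in> U \<times> G. \<forall>i\<in>A. X i t = X i (u, g)} = C u \<times> G"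
        proof (intro set_eqI)
          fix t :: "(int \<times> int \<times> int) \<times> nat"
          obtain x' y' z' g' where t: "t = ((x', y', z'), g')" by (metis prod.exhaust)
          show "t \<in> {t \<in> U \<times> G. \<forall>i\<in>A. X i t = X i (u, g)} \<longleftrightarrow> t \<in> C u \<times> G"
          proof (cases "(x', y', z') \<in> U")
            case True
            then have "y' \<in> V" by (simp add: U_def)
            then show ?thesis
              using True X1(1)[OF True, of g' x y z g] by (auto simp: t u 2 C_def)
          next
            case False
            then show ?thesis using sub by (auto simp: t)
          qed
        qed
        ultimately show "{t \<in> U \<times> G. \<forall>i\<in>A. X i t = X i (u, g)} = C u \<times> G \<and> C u \<subseteq> U \<and> card (C u) = nat v ^ 1"
          using sub by blast
      qed
      then show ?thesis by (simp add: 2 h_eval)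
    next
      case 3
      have "finite A" using A by (rule finite_subset) simp
      then have "card {1, i} \<le> card A" using 3 by (intro card_mono) auto
      then have "2 \<le> card A" using 3 by auto
      then have "U_hat_1_35 A = 3" using 3 by (simp add: U_hat_1_35_def)
      moreover have "card (A \<inter> {2, 3, 4}) \<noteq> 0" using 3 by auto
      then have "U_234_13 A = 1" unfolding U_234_13_def by linarith
      moreover have "prob_space.entropy M 2 (count_space (subvector X A ` space M)) (subvector X A) = (3 - real 0) * a + b"
      proof (rule ent_dep[where C = "\<lambda>u. {u}"])
        fix u g assume ug: "u \<in> U" "g \<in> G"
        \<comment> \<open>\<open>X i\<close> reveals \<open>g\<close> and one residue; the matching
          form of \<open>X1\<close> recovers the other two. So nothing remains free and
          \<open>k\<close> = 0.\<close>
        have "t = (u, g)" if t: "t \<in> U \<times> G" "\<forall>i\<in>A. X i t = X i (u, g)" for t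
        proof -
          obtain x y z where u: "u = (x, y, z)" by (cases u)
          obtain x' y' z' g' where t': "t = ((x', y', z'), g')" by (metis prod.exhaust)
          have inU: "(x', y', z') \<in> U" using t(1) t' by simp
          have xyz: "x mod v = x" "y mod v = y" "z mod v = z" using ug(1) by (auto simp: u U_def V_def)
          have "X 1 ((x', y', z'), g') = X 1 ((x, y, z), g)" "X i ((x', y', z'), g') = X i ((x, y, z), g)"
            using t(2) 3 by (auto simp: t' u)
          then show ?thesis
            using X1[OF inU, of g' x y z g] 3(3) xyz by (auto simp: X_def[of i] t' u)
        qed
        then show "{t \<in> U \<times> G. \<forall>i\<in>A. X i t = X i (u, g)} = {u} \<times> {g} \<and> {u} \<subseteq> U \<and> card {u} = nat v ^ 0"
          using ug by auto
      qed
      ultimately show ?thesis by (simp add: face_point_def)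
    next
      case 4
      \<comment> \<open>Residues whose index lies outside \<open>A\<close> are free, so
        \<open>k\<close> = \<open>3 - card A\<close>.\<close>
      define C where "C = (\<lambda>(x, y, z). (if 2 \<in> A then {x} else V) \<times> (if 3 \<in> A then {y} else V) \<times> (if 4 \<in> A then {z} else V))"
      have sub: "A \<subseteq> {2, 3, 4}" using A 4 by auto
      then have A_eq: "A = (if 2 \<in> A then {2} else {}) \<union> (if 3 \<in> A then {3} else {}) \<union> (if 4 \<in> A then {4} else {})"
        by auto
      have card_A: "card A = (if 2 \<in> A then 1 else 0) + (if 3 \<in> A then 1 else 0) + (if 4 \<in> A then 1 else 0)"
        by (subst A_eq) simp
      have "prob_space.entropy M 2 (count_space (subvector X A ` space M)) (subvector X A) = (3 - real (3 - card A)) * a + b"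
      proof (rule ent_dep[where C = C])
        fix u g assume ug: "u \<in> U" "g \<in> G"
        obtain x y z where u: "u = (x, y, z)" by (cases u)
        have "C u \<subseteq> U" using ug by (auto simp: C_def u U_def split: if_splits)
        moreover have "card (C u) = nat v ^ (3 - card A)"
          unfolding card_A
          by (simp add: C_def u card_cartesian_product card_V power2_eq_square power3_eq_cube)
        moreover have "{t \<in> U \<times> G. \<forall>i\<in>A. X i t = X i (u, g)} = C u \<times> {g}"
        proof (intro set_eqI)
          fix t :: "(int \<times> int \<times> int) \<times> nat"
          obtain x' y' z' g' where t: "t = ((x', y', z'), g')" by (metis prod.exhaust)
          have "(\<forall>i\<in>A. X i t = X i (u, g))
              \<longleftrightarrow> g' = g \<and> (2 \<in> A \<longrightarrow> x' = x) \<and> (3 \<in> A \<longrightarrow> y' = y) \<and> (4 \<in> A \<longrightarrow> z' = z)"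
          proof -
            have "X 2 t = X 2 (u, g) \<longleftrightarrow> x' = x \<and> g' = g" "X 3 t = X 3 (u, g) \<longleftrightarrow> y' = y \<and> g' = g"
              "X 4 t = X 4 (u, g) \<longleftrightarrow> z' = z \<and> g' = g"
              by (auto simp: X_def t u)
            moreover have "(\<forall>i\<in>A. X i t = X i (u, g)) \<longleftrightarrow> (2 \<in> A \<longrightarrow> X 2 t = X 2 (u, g))
                \<and> (3 \<in> A \<longrightarrow> X 3 t = X 3 (u, g)) \<and> (4 \<in> A \<longrightarrow> X 4 t = X 4 (u, g))"
              using sub by blast
            moreover have "2 \<in> A \<or> 3 \<in> A \<or> 4 \<in> A" using 4 sub by blast
            ultimately show ?thesis by blast
          qed
          then show "t \<in> {t \<in> U \<times> G. \<forall>i\<in>A. X i t = X i (u, g)} \<longleftrightarrow> t \<in> C u \<times> {g}"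
            using ug by (auto simp: t u C_def U_def)
        qed
        ultimately show "{t \<in> U \<times> G. \<forall>i\<in>A. X i t = X i (u, g)} = C u \<times> {g} \<and> C u \<subseteq> U \<and> card (C u) = nat v ^ (3 - card A)"
          by blast
      qed
      \<comment> \<open>The subtraction of naturals does not truncate, as \<open>card_A\<close>
        bounds \<open>card A\<close> by 3.\<close>
      moreover have "3 - real (3 - card A) = card A" using card_A by auto
      moreover have "U_hat_1_35 A = card A" using 4 by (simp add: U_hat_1_35_def)
      moreover have "U_234_13 A = 1"
      proof -
        have "A \<inter> {2, 3, 4} = A" "finite A" using sub finite_subset by auto
        then have "card (A \<inter> {2, 3, 4}) \<noteq> 0" using 4 by simp
        then show ?thesis unfolding U_234_13_def by linarith
      qed
      ultimately show ?thesis by (simp add: face_point_def)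
    qed
  qed
  moreover have "prob_space M" unfolding M_def by (rule prob_space_uniform_product[OF prod])
  moreover have "simple_function M (X i)" for i
    unfolding M_def by (rule simple_function_uniform_product[OF prod])
  moreover have "face_point U_hat_1_35 U_234_13 a b {} = 0" by (simp add: h_eval)
  ultimately have "has_entropy_function M X (face_point U_hat_1_35 U_234_13 a b)"
    unfolding has_entropy_function_def by blast
  then show ?thesis by (rule entropic_if_has_entropy_function)
qed

theorem mainTheorem18:
  fixes a b :: real
  assumes "0 \<le> a" and "0 \<le> b"
  shows "entropic (face_point U_hat_1_35 U_234_13 a b) \<longleftrightarrow>
    (\<exists>v::int. v \<ge> 1 \<and> a = log 2 (real_of_int v))"
proof
  assume "entropic (face_point U_hat_1_35 U_234_13 a b)"
  then show "\<exists>v::int. v \<ge> 1 \<and> a = log 2 (real_of_int v)"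
    unfolding entropic_def using log_if_has_entropy_function by blast
next
  assume "\<exists>v::int. v \<ge> 1 \<and> a = log 2 (real_of_int v)"
  then show "entropic (face_point U_hat_1_35 U_234_13 a b)"
    using entropic_if_log assms(2) by blast
qed

end
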